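(* Consider the following two assertions. (F) For all positive integers $k,\omega,n$ and every subset $A=[0,n-k-1]\cup\{i_0,i_1,\ldots,i_{k-1}\}$ of $\mathbb{Z}_\omega$ with $|A|=n\ge 2k+1$: if $A$ is a direct factor of $\mathbb{Z}_\omega$, then $\{i_0,i_1,\ldots,i_{k-1}\}\equiv\{n-k,n-k+1,\ldots,n-1\}\pmod n$. (S) For all positive integers $m,n,k$ with $m\ge 2$ and all nonnegative integers $i_0,\ldots,i_{k-1}$, letting $M=\{1,m,m^2,\ldots,m^{n-k-1},m^{i_0},m^{i_1},\ldots,m^{i_{k-1}}\}$: if $M$ splits a finite abelian group $G$ and $|M|=n\ge 2k+1$, then $\{i_0,i_1,\ldots,i_{k-1}\}\equiv\{n-k,n-k+1,\ldots,n-1\}\pmod n$. If (F) holds, then (S) also holds.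
   Context: For an additively written finite abelian group $G$ and nonempty subsets $A,B\subseteq G$, $G=A+B$ is a factorization if every $g\in G$ can be written in exactly one way as $g=a+b$ with $a\in A$, $b\in B$. A subset $A$ is a direct factor of $G$ if there is $B\subseteq G$ such that $G=A+B$ is a factorization. $\mathbb{Z}_\omega$ is the cyclic group of order $\omega$; for integers $a\le b$, $[a,b]=\{x\in\mathbb{Z}:a\le x\le b\}$, viewed in $\mathbb{Z}_\omega$ via reduction modulo $\omega$. A set $M$ of integers splits a finite abelian group $G$ (written additively) if there is a subset $S\subseteq G$ such that every nonzero $g\in G$ has a unique representation $g=ms$ with $m\in M$, $s\in S$, while $0$ has no such representation (here $ms$ is the usual integer multiple of $s$). $X\equiv Y\pmod n$ means that $X$ and $Y$ have the same set of residues modulo $n$ (in (F), $n$ divides $\omega$ whenever $A$ is a direct factor, so residues modulo $n$ are well defined).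
   Formalization: In (S) the group G is assumed nontrivial: every M splits the trivial group (with S empty), so (S) as written fails there, e.g. m=2, k=1, n=3, i_0=3, M={1,2,8}. *)

theory Defs
  imports "HOL-Algebra.Elementary_Groups"
begin

text \<open>
  HOL-Algebra writes groups multiplicatively: a sum \<open>a + b\<close> in an abelian group is
  \<open>a \<otimes>\<^bsub>G\<^esub> b\<close>, the zero element is \<open>\<one>\<^bsub>G\<^esub>\<close>, and the integer multiple \<open>m s\<close> is
  \<open>s [^]\<^bsub>G\<^esub> m\<close>. For \<open>n > 0\<close>, \<^const>\<open>integer_mod_group\<close> \<open>n\<close> is addition modulo \<open>n\<close> on the
  representatives \<open>{0..<n}\<close>.
\<close>

definition factorization ::
  "('a, 'b) monoid_scheme \<Rightarrow> 'a set \<Rightarrow> 'a set \<Rightarrow> bool" where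
  "factorization G A B \<longleftrightarrow>
     A \<noteq> {} \<and> B \<noteq> {} \<and> A \<subseteq> carrier G \<and> B \<subseteq> carrier G \<and>
     (\<forall>g \<in> carrier G. \<exists>!p. p \<in> A \<times> B \<and> g = fst p \<otimes>\<^bsub>G\<^esub> snd p)"

definition direct_factor :: "('a, 'b) monoid_scheme \<Rightarrow> 'a set \<Rightarrow> bool" where
  "direct_factor G A \<longleftrightarrow> (\<exists>B. factorization G A B)"

text \<open>
  The set \<open>S\<close> may be empty, so every \<open>M\<close> splits the trivial group.
\<close>

definition splits :: "int set \<Rightarrow> ('a, 'b) monoid_scheme \<Rightarrow> bool" where
  "splits M G \<longleftrightarrow>
     (\<exists>S \<subseteq> carrier G.
        (\<forall>g \<in> carrier G - {\<one>\<^bsub>G\<^esub>}. \<exists>!p. p \<in> M \<times> S \<and> g = snd p [^]\<^bsub>G\<^esub> fst p) \<and>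
        \<not> (\<exists>p \<in> M \<times> S. \<one>\<^bsub>G\<^esub> = snd p [^]\<^bsub>G\<^esub> fst p))"

definition same_residues :: "int set \<Rightarrow> int set \<Rightarrow> nat \<Rightarrow> bool" where
  "same_residues X Y n \<longleftrightarrow> (\<lambda>x. x mod int n) ` X = (\<lambda>x. x mod int n) ` Y"

end

theory Submission
  imports Defs "HOL-Number_Theory.Pocklington"
begin

text \<open>
  Every element of \<open>G\<close> that is not an \<open>m\<close>-th power lies in the splitting set, which has fewer
  than \<open>|G| / 3\<close> elements; a nontrivial kernel of \<open>x \<mapsto> x [^] m\<close> would leave at least \<open>|G| / 2\<close>
  such elements. So this map permutes \<open>G\<close>, and restricting the splitting to one orbit of length
  \<open>\<omega>\<close> turns it into a factorization of the integers modulo \<open>\<omega>\<close> by the set of exponents.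
  Then \<open>n\<close> divides \<open>\<omega>\<close>, so reducing the exponents modulo \<open>\<omega>\<close> does not change their residues
  modulo \<open>n\<close>.
\<close>

section \<open>Splittings by powers of \<open>m\<close> in terms of exponents\<close>

text \<open>The counting and orbit arguments need natural exponents and a bijection onto the
  nonidentity elements instead of integer multipliers. As \<open>m \<ge> 2\<close>, an exponent can
  be recovered from its power of \<open>m\<close>, so uniqueness of the representation becomes
  injectivity on pairs \<open>(e, s)\<close>.\<close>

lemma splits_powersE:
  fixes G (structure) and m :: nat
  assumes "group G" and m: "m \<ge> 2" and spl: "splits ((\<lambda>e. int m ^ e) ` E) G"
  obtains S where "S \<subseteq> carrier G"
    and "(\<lambda>(e, s). s [^] m ^ e) ` (E \<times> S) = carrier G - {\<one>}"
    and "inj_on (\<lambda>(e, s). s [^] m ^ e) (E \<times> S)"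
proof -
  interpret group G by fact
  let ?f = "\<lambda>(e, s). s [^] m ^ e" and ?M = "(\<lambda>e. int m ^ e) ` E"
  have pow: "s [^] (int m ^ e) = s [^] (m ^ e)" for s e
    by (metis int_pow_int of_nat_power)
  obtain S where S: "S \<subseteq> carrier G"
    and ex1: "\<And>x. x \<in> carrier G - {\<one>} \<Longrightarrow> \<exists>!p. p \<in> ?M \<times> S \<and> x = snd p [^] fst p"
    and no: "\<And>p. p \<in> ?M \<times> S \<Longrightarrow> \<one> \<noteq> snd p [^] fst p"
    using spl unfolding splits_def by metis
  have sub: "s [^] m ^ e \<in> carrier G - {\<one>}" if "e \<in> E" "s \<in> S" for e s
    using no[of "(int m ^ e, s)"] that S by (auto simp: pow)
  have "?f ` (E \<times> S) = carrier G - {\<one>}"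
  proof
    show "?f ` (E \<times> S) \<subseteq> carrier G - {\<one>}"
      by (rule image_subsetI, unfold mem_Times_iff case_prod_beta) (rule sub; simp)
    show "carrier G - {\<one>} \<subseteq> ?f ` (E \<times> S)"
    proof
      fix x assume "x \<in> carrier G - {\<one>}"
      then obtain p where "p \<in> ?M \<times> S" "x = snd p [^] fst p"
        using ex1_implies_ex[OF ex1] by blast
      then obtain e s where "e \<in> E" "s \<in> S" "x = s [^] m ^ e"
        using pow by auto
      then show "x \<in> ?f ` (E \<times> S)"
        by (intro image_eqI[of _ _ "(e, s)"]) auto
    qed
  qed
  moreover have "inj_on ?f (E \<times> S)"
  proof (rule inj_onI, elim SigmaE, simp only: case_prod_conv prod.inject)
    fix e s e' s'
    assume *: "e \<in> E" "s \<in> S" "e' \<in> E" "s' \<in> S" and eq: "s [^] m ^ e = s' [^] m ^ e'"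
    obtain q where "\<And>p. p \<in> ?M \<times> S \<Longrightarrow> s [^] m ^ e = snd p [^] fst p \<Longrightarrow> p = q"
      using ex1[OF sub[OF *(1,2)]] by metis
    from this[of "(int m ^ e, s)"] this[of "(int m ^ e', s')"]
    have "(int m ^ e, s) = (int m ^ e', s')"
      using * eq by (simp add: pow)
    then show "e = e' \<and> s = s'"
      using m by simp
  qed
  ultimately show thesis
    using S that by blast
qed

section \<open>Injectivity of the m-th power map\<close>

text \<open>The fibres of \<open>h\<close> over its image are the cosets of the kernel, and
  Lagrange's theorem counts these.\<close>

lemma (in group_hom) card_kernel_image:
  assumes "finite (carrier G)"
  shows "card (kernel G H h) * card (h ` carrier G) = card (carrier G)"
proof -
  let ?K = "kernel G H h"
  have elem: "the_elem (h ` (?K #> g)) = h g" if "g \<in> carrier G" for g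
  proof -
    have "h ` (?K #> g) = {h g}"
      using that G.subgroup_self G.rcos_self[OF that subgroup_kernel]
      by (auto simp: kernel_def r_coset_def)
    then show ?thesis by simp
  qed
  have "(\<lambda>X. the_elem (h ` X)) ` (rcosets ?K) = h ` carrier G"
    by (force simp: RCOSETS_def elem image_iff)
  then have "card (rcosets ?K) = card (h ` carrier G)"
    using card_image[OF FactGroup_inj_on] by (simp add: FactGroup_def)
  then show ?thesis
    using G.lagrange_finite[OF assms subgroup_kernel] by (simp add: order_def mult.commute)
qed

lemma (in comm_group) inj_on_pow_if_splitting:
  fixes m :: nat
  assumes fin: "finite (carrier G)" and "S \<subseteq> carrier G" "0 \<in> E" "card E \<ge> 3"
    and im: "(\<lambda>(e, s). s [^] m ^ e) ` (E \<times> S) = carrier G - {\<one>}"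
    and inj: "inj_on (\<lambda>(e, s). s [^] m ^ e) (E \<times> S)"
  shows "inj_on (\<lambda>x. x [^] m) (carrier G)"
proof -
  let ?h = "\<lambda>x. x [^] m"
  interpret h: group_hom G G ?h
    by unfold_locales (auto simp: hom_def pow_mult_distrib m_comm)
  have finS: "finite S"
    using fin assms(2) finite_subset by blast
  have "x \<in> ?h ` carrier G \<union> S" if x: "x \<in> carrier G" for x
  proof (cases "x = \<one>")
    case False
    with x im have "x \<in> (\<lambda>(e, s). s [^] m ^ e) ` (E \<times> S)"
      by simp
    then obtain e s where s: "s \<in> S" "x = s [^] m ^ e"
      by auto
    \<comment> \<open>Exponent 0 puts \<open>x\<close> itself into \<open>S\<close>; a positive
      exponent exhibits \<open>x\<close> as an m-th power.\<close>
    show ?thesis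
    proof (cases e)
      case (Suc e')
      have "s \<in> carrier G"
        using assms(2) s(1) by blast
      then have "x = (s [^] m ^ e') [^] m" "s [^] m ^ e' \<in> carrier G"
        using s(2) Suc by (simp_all add: nat_pow_pow mult.commute)
      then show ?thesis by blast
    qed (use s assms(2) in auto)
  next
    case True
    then have "x = \<one> [^] m" by simp
    then show ?thesis by blast
  qed
  then have "carrier G \<subseteq> ?h ` carrier G \<union> S"
    by blast
  then have cover: "card (carrier G) \<le> card (?h ` carrier G) + card S"
    by (meson card_Un_le card_mono fin finS finite_UnI finite_imageI le_trans)
  have "card E * card S = card (carrier G) - 1"
    using card_image[OF inj] im fin by (simp add: card_cartesian_product)
  then have S: "3 * card S \<le> card (carrier G) - 1"
    using \<open>card E \<ge> 3\<close> by (metis mult_le_mono1)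
  have "card (carrier G) > 0"
    using fin one_closed card_gt_0_iff by blast
  \<comment> \<open>With N the order of the group, a kernel of at least two elements would give N
    \<le> N/2 + (N - 1)/3, which is impossible.\<close>
  from cover have "card (kernel G G ?h) < 2"
  proof (rule contrapos_pp)
    assume "\<not> card (kernel G G ?h) < 2"
    then have "2 * card (?h ` carrier G) \<le> card (carrier G)"
      using h.card_kernel_image[OF fin] by (metis mult_le_mono1 not_less)
    with S \<open>card (carrier G) > 0\<close> show "\<not> card (carrier G) \<le> card (?h ` carrier G) + card S"
      by linarith
  qed
  moreover have "finite (kernel G G ?h)" "\<one> \<in> kernel G G ?h"
    using fin by (auto simp: kernel_def)
  ultimately have "x = \<one>" if "x \<in> kernel G G ?h" for x
    using that card_le_Suc0_iff_eq[of "kernel G G ?h"] by (auto simp: less_Suc_eq_le numeral_2_eq_2)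
  then show ?thesis
    unfolding h.inj_on_one_iff kernel_def by blast
qed

section \<open>Orbits of the m-th power map\<close>

text \<open>For d the gcd, the power of \<open>g\<close> with exponent \<open>ord g\<close> / d has
  m-th power one, so it is one by injectivity. Then \<open>ord g\<close> divides
  \<open>ord g\<close> / d, which forces d = 1. Positivity excludes infinite order, encoded as
  \<open>ord g = 0\<close>.\<close>

lemma (in group) coprime_ord_if_inj_on_pow:
  fixes m :: nat
  assumes "inj_on (\<lambda>x. x [^] m) (carrier G)" "g \<in> carrier G" "ord g > 0"
  shows "coprime (ord g) m"
proof -
  let ?d = "gcd (ord g) m"
  obtain a c where a: "ord g = ?d * a" and c: "m = ?d * c"
    by (meson dvdE gcd_dvd1 gcd_dvd2)
  have "a * m = ord g * c"
    by (subst a, subst c) (simp only: ac_simps)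
  then have "(g [^] a) [^] m = \<one> [^] m"
    using assms(2) by (simp add: nat_pow_pow pow_eq_id)
  then have "g [^] a = \<one>"
    by (rule inj_onD[OF assms(1)]) (use assms(2) in auto)
  then have "ord g dvd a"
    using assms(2) pow_eq_id by blast
  with a assms(3) have "?d dvd 1"
    by (metis dvd_times_right_cancel_iff mult_1 mult_0_right neq0_conv)
  then show ?thesis
    by (simp add: coprime_iff_gcd_eq_1)
qed

text \<open>Taking m-th powers moves one step along the orbit of \<open>g\<close>, so in terms of
  positions the exponent \<open>e\<close> acts as addition of \<open>e\<close> modulo the orbit
  length. Injectivity allows stepping backwards, so any element of \<open>S\<close> that represents
  an orbit point lies in the orbit as well.\<close>

lemma (in group) splitting_imp_factorization:
  fixes m :: nat
  assumes "S \<subseteq> carrier G"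
    and im: "(\<lambda>(e, s). s [^] m ^ e) ` (E \<times> S) = carrier G - {\<one>}"
    and inj: "inj_on (\<lambda>(e, s). s [^] m ^ e) (E \<times> S)"
    and injm: "inj_on (\<lambda>x. x [^] m) (carrier G)"
    and g: "g \<in> carrier G" "g \<noteq> \<one>" "ord g > 0"
  obtains \<omega> where "\<omega> > 0" "inj_on (\<lambda>e. int e mod int \<omega>) E"
    "direct_factor (integer_mod_group \<omega>) ((\<lambda>e. int e mod int \<omega>) ` E)"
proof -
  \<comment> \<open>The multiplicative order of \<open>m\<close> modulo the order of
    \<open>g\<close>. It would be 0 without coprimality.\<close>
  define \<omega> where "\<omega> = Pocklington.ord (ord g) m"
  have cop: "coprime (ord g) m"
    using coprime_ord_if_inj_on_pow injm g by blast
  then have \<omega>: "\<omega> > 0"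
    by (simp add: \<omega>_def)
  have pow_iff: "g [^] m ^ a = g [^] m ^ b \<longleftrightarrow> a mod \<omega> = b mod \<omega>" for a b
  proof -
    have "g [^] m ^ a = g [^] m ^ b \<longleftrightarrow> [int (m ^ a) = int (m ^ b)] (mod int (ord g))"
      using int_pow_eq[OF g(1), of "int (m ^ a)" "int (m ^ b)"]
      by (simp only: int_pow_int cong_iff_dvd_diff dvd_diff_commute)
    also have "\<dots> \<longleftrightarrow> [a = b] (mod \<omega>)"
      unfolding cong_int_iff \<omega>_def using order_divides_expdiff[OF cop] .
    finally show ?thesis
      by (simp add: cong_def)
  qed
  have injpow: "inj_on (\<lambda>x. x [^] m ^ e) (carrier G)" for e
  proof (induction e)
    case (Suc e)
    have "inj_on ((\<lambda>x. x [^] m ^ e) \<circ> (\<lambda>x. x [^] m)) (carrier G)"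
      by (rule comp_inj_on[OF injm inj_on_subset[OF Suc]]) auto
    then show ?case
      by (rule inj_on_cong[THEN iffD1, rotated]) (simp add: nat_pow_pow)
  qed (simp add: inj_on_def)
  \<comment> \<open>The positions, within one period, of the orbit elements that belong to
    \<open>S\<close>.\<close>
  define B where "B = {b. b < \<omega> \<and> g [^] m ^ b \<in> S}"
  have add: "(g [^] m ^ b) [^] m ^ e = g [^] m ^ (e + b)" for b e
    using g(1) by (simp add: nat_pow_pow power_add mult.commute)
  have unique: "e = e' \<and> b = b'"
    if "e \<in> E" "e' \<in> E" "b \<in> B" "b' \<in> B" "(e + b) mod \<omega> = (e' + b') mod \<omega>" for e e' b b'
  proof -
    \<comment> \<open>Injectivity of the splitting applies to these pairs; afterwards
      \<open>b\<close> is recovered from its orbit element because members of \<open>B\<close> lie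
      below \<open>\<omega>\<close>.\<close>
    have "(e, g [^] m ^ b) = (e', g [^] m ^ b')"
      using that by (intro inj_onD[OF inj]) (auto simp: add pow_iff B_def)
    with that show ?thesis
      by (auto simp: pow_iff B_def)
  qed
  have exist: "\<exists>e\<in>E. \<exists>b\<in>B. t mod \<omega> = (e + b) mod \<omega>" for t
  proof -
    have "g [^] m ^ t \<noteq> \<one>"
      using inj_onD[OF injpow, of g t \<one>] g by auto
    then have "g [^] m ^ t \<in> (\<lambda>(e, s). s [^] m ^ e) ` (E \<times> S)"
      using im g by simp
    then obtain e s where es: "e \<in> E" "s \<in> S" "g [^] m ^ t = s [^] m ^ e"
      by auto
    \<comment> \<open>Modulo \<open>\<omega>\<close>, \<open>e * (\<omega> - 1)\<close> is -e, so
      \<open>b\<close> is the position \<open>e\<close> steps before \<open>t\<close>; this form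
      avoids the truncated difference \<open>t - e\<close>.\<close>
    define b where "b = (t + e * (\<omega> - 1)) mod \<omega>"
    have "(e + b) mod \<omega> = (e + (t + e * (\<omega> - 1))) mod \<omega>"
      by (simp add: b_def mod_simps)
    also have "e + (t + e * (\<omega> - 1)) = t + e * \<omega>"
      using \<omega> by (cases \<omega>) auto
    finally have eb: "(e + b) mod \<omega> = t mod \<omega>"
      by simp
    \<comment> \<open>Two elements with the same \<open>m ^ e\<close>-th power coincide, which
      places \<open>s\<close> in the orbit.\<close>
    have "(g [^] m ^ b) [^] m ^ e = s [^] m ^ e"
      using eb es(3) by (simp add: add flip: pow_iff)
    then have "g [^] m ^ b = s"
      using inj_onD[OF injpow, of "g [^] m ^ b" e s] es(2) assms(1) g(1) by auto
    with es(2) \<omega> have "b \<in> B"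
      by (simp add: B_def b_def)
    with es(1) eb show ?thesis by metis
  qed
  have injE: "inj_on (\<lambda>e. int e mod int \<omega>) E"
  proof (rule inj_onI)
    fix e e' assume e: "e \<in> E" "e' \<in> E" "int e mod int \<omega> = int e' mod int \<omega>"
    \<comment> \<open>Shifting two congruent exponents by the same position in \<open>B\<close>
      represents one residue twice.\<close>
    obtain b where "b \<in> B" using exist by blast
    moreover from e have "e mod \<omega> = e' mod \<omega>"
      by (simp flip: zmod_int)
    ultimately show "e = e'"
      using unique[of e e' b b] e by (metis mod_add_left_eq)
  qed
  have "factorization (integer_mod_group \<omega>) ((\<lambda>e. int e mod int \<omega>) ` E) (int ` B)"
    unfolding factorization_def
  proof (intro conjI ballI)
    fix x assume "x \<in> carrier (integer_mod_group \<omega>)"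
    then obtain t where t: "x = int t" "t < \<omega>"
      using \<omega> by (auto simp: carrier_integer_mod_group dest!: zero_le_imp_eq_int)
    obtain e b where eb: "e \<in> E" "b \<in> B" "t = (e + b) mod \<omega>"
      using exist[of t] t by auto
    show "\<exists>!p. p \<in> (\<lambda>e. int e mod int \<omega>) ` E \<times> int ` B \<and>
        x = fst p \<otimes>\<^bsub>integer_mod_group \<omega>\<^esub> snd p"
    proof (rule ex1I[of _ "(int e mod int \<omega>, int b)"])
      show "(int e mod int \<omega>, int b) \<in> (\<lambda>e. int e mod int \<omega>) ` E \<times> int ` B \<and>
        x = fst (int e mod int \<omega>, int b) \<otimes>\<^bsub>integer_mod_group \<omega>\<^esub> snd (int e mod int \<omega>, int b)"
        using eb t by (auto simp: mod_simps zmod_int)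
    next
      fix p
      assume p: "p \<in> (\<lambda>e. int e mod int \<omega>) ` E \<times> int ` B \<and>
        x = fst p \<otimes>\<^bsub>integer_mod_group \<omega>\<^esub> snd p"
      then obtain e' b' where p': "e' \<in> E" "b' \<in> B" "p = (int e' mod int \<omega>, int b')"
        by auto
      with p t have "int t = (int e' + int b') mod int \<omega>"
        by (simp add: mod_simps)
      then have "t = (e' + b') mod \<omega>"
        by (metis of_nat_add of_nat_eq_iff zmod_int)
      then show "p = (int e mod int \<omega>, int b)"
        using unique[of e e' b b'] eb p' by auto
    qed
  qed (use \<omega> exist in \<open>auto simp: carrier_integer_mod_group B_def\<close>)
  then show thesis
    using that[OF \<omega> injE] by (auto simp: direct_factor_def)
qed

section \<open>From the factorization to residues modulo \<open>n\<close>\<close>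

text \<open>Unique representation makes the group operation a bijection from
  \<open>A \<times> B\<close> onto the carrier.\<close>

lemma (in monoid) card_direct_factor_dvd:
  assumes "direct_factor G A"
  shows "card A dvd card (carrier G)"
proof -
  obtain B where "factorization G A B"
    using assms unfolding direct_factor_def by blast
  then have B: "A \<subseteq> carrier G" "B \<subseteq> carrier G"
    "\<And>g. g \<in> carrier G \<Longrightarrow> \<exists>!p. p \<in> A \<times> B \<and> g = fst p \<otimes> snd p"
    unfolding factorization_def by simp_all
  have closed: "fst p \<otimes> snd p \<in> carrier G" if "p \<in> A \<times> B" for p
    using that B(1,2) by (auto simp: subset_iff)
  have "bij_betw (\<lambda>p. fst p \<otimes> snd p) (A \<times> B) (carrier G)"
    unfolding bij_betw_def
  proof
    show "inj_on (\<lambda>p. fst p \<otimes> snd p) (A \<times> B)"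
      by (rule inj_onI) (use B(3)[OF closed] in blast)
    show "(\<lambda>p. fst p \<otimes> snd p) ` (A \<times> B) = carrier G"
      using B(3) closed by blast
  qed
  then show ?thesis
    by (metis bij_betw_same_card card_cartesian_product dvd_triv_left)
qed

theorem proposition8:
  assumes F:
    "\<forall>(k::nat) (\<omega>::nat) (n::nat) (i :: nat \<Rightarrow> int) (A :: int set).
       k > 0 \<longrightarrow> \<omega> > 0 \<longrightarrow> n > 0 \<longrightarrow>
       (\<forall>j<k. i j \<in> carrier (integer_mod_group \<omega>)) \<longrightarrow>
       A = (\<lambda>x. x mod int \<omega>) ` {0..int n - int k - 1} \<union> {i j | j. j < k} \<longrightarrow>
       card A = n \<longrightarrow> n \<ge> 2 * k + 1 \<longrightarrow>
       direct_factor (integer_mod_group \<omega>) A \<longrightarrow>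
       same_residues {i j | j. j < k} {int n - int k..int n - 1} n"
  shows
    "\<forall>(m::nat) (n::nat) (k::nat) (i :: nat \<Rightarrow> nat) (M :: int set) (G :: ('g, 'h) monoid_scheme).
       m \<ge> 2 \<longrightarrow> n > 0 \<longrightarrow> k > 0 \<longrightarrow>
       M = {int m ^ j | j. j \<le> n - k - 1} \<union> {int m ^ i j | j. j < k} \<longrightarrow>
       comm_group G \<longrightarrow> finite (carrier G) \<longrightarrow> carrier G \<noteq> {\<one>\<^bsub>G\<^esub>} \<longrightarrow>
       splits M G \<longrightarrow> card M = n \<longrightarrow> n \<ge> 2 * k + 1 \<longrightarrow>
       same_residues {int (i j) | j. j < k} {int n - int k..int n - 1} n"
proof (intro allI impI)
  fix m n k :: nat and i :: "nat \<Rightarrow> nat" and M :: "int set" and G :: "('g, 'h) monoid_scheme"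
  assume m: "m \<ge> 2" and "n > 0" and k: "k > 0"
    and M: "M = {int m ^ j | j. j \<le> n - k - 1} \<union> {int m ^ i j | j. j < k}"
    and G: "comm_group G" "finite (carrier G)" "carrier G \<noteq> {\<one>\<^bsub>G\<^esub>}"
    and spl: "splits M G" and card: "card M = n" and n: "n \<ge> 2 * k + 1"
  interpret comm_group G by fact
  define E where "E = {..n - k - 1} \<union> i ` {..<k}"
  have ME: "M = (\<lambda>e. int m ^ e) ` E"
    unfolding M E_def by auto
  have "inj_on (\<lambda>e. int m ^ e) E"
    using m by (simp add: inj_on_def)
  with ME card have cardE: "card E = n"
    by (simp add: card_image)
  obtain S where S: "S \<subseteq> carrier G"
    "(\<lambda>(e, s). s [^]\<^bsub>G\<^esub> m ^ e) ` (E \<times> S) = carrier G - {\<one>\<^bsub>G\<^esub>}"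
    "inj_on (\<lambda>(e, s). s [^]\<^bsub>G\<^esub> m ^ e) (E \<times> S)"
    using splits_powersE[OF is_group m spl[unfolded ME]] by blast
  \<comment> \<open>\<open>n \<ge> 2 * k + 1\<close> and \<open>k > 0\<close> supply the three
    exponents for the counting bound; exponent 0 comes from the initial block.\<close>
  have injm: "inj_on (\<lambda>x. x [^]\<^bsub>G\<^esub> m) (carrier G)"
    using n k by (intro inj_on_pow_if_splitting[OF G(2) S(1) _ _ S(2,3)])
      (auto simp: cardE, simp add: E_def)
  obtain g where g: "g \<in> carrier G" "g \<noteq> \<one>\<^bsub>G\<^esub>"
    using G(3) by blast
  have "group.ord G g > 0"
    using ord_ge_1[OF G(2) g(1)] by simp
  from splitting_imp_factorization[OF S injm g this]
  obtain \<omega> where \<omega>: "\<omega> > 0" and inj: "inj_on (\<lambda>e. int e mod int \<omega>) E"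
    and df: "direct_factor (integer_mod_group \<omega>) ((\<lambda>e. int e mod int \<omega>) ` E)" (is "direct_factor _ ?A") .
  have cardA: "card ?A = n"
    using inj cardE by (simp add: card_image)
  \<comment> \<open>The bound on \<open>n\<close> prevents truncation, so the natural and the
    integer endpoint agree.\<close>
  have "int ` {..n - k - 1} = {0..int n - int k - 1}"
    unfolding atMost_atLeast0 image_int_atLeastAtMost using n by simp
  then have "(\<lambda>e. int e mod int \<omega>) ` {..n - k - 1} = (\<lambda>x. x mod int \<omega>) ` {0..int n - int k - 1}"
    by (simp only: image_image flip: \<open>int ` {..n - k - 1} = _\<close>)
  moreover have "(\<lambda>e. int e mod int \<omega>) ` i ` {..<k} = {int (i j) mod int \<omega> | j. j < k}"
    by auto
  ultimately have A: "?A = (\<lambda>x. x mod int \<omega>) ` {0..int n - int k - 1} \<union> {int (i j) mod int \<omega> | j. j < k}"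
    unfolding E_def image_Un by simp
  \<comment> \<open>(F) speaks of elements of the cyclic group, so it is applied to the exponents
    \<open>i j\<close> reduced modulo \<open>\<omega>\<close>.\<close>
  have "same_residues {int (i j) mod int \<omega> | j. j < k} {int n - int k..int n - 1} n"
    using F[rule_format, OF k \<omega> \<open>n > 0\<close> _ A cardA n df] \<omega>
    by (simp add: carrier_integer_mod_group)
  moreover have "int n dvd int \<omega>"
    using monoid.card_direct_factor_dvd[OF group.is_monoid[OF group_integer_mod_group] df] \<omega> by (simp add: cardA carrier_integer_mod_group)
  ultimately show "same_residues {int (i j) | j. j < k} {int n - int k..int n - 1} n"
    by (simp add: same_residues_def setcompr_eq_image image_image mod_mod_cancel)
qed

end
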